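(* Let $n\ge 1$, let $K_n$ be the complete graph on $n$ vertices, and let $G$ be a simple connected graph. If $D^{\deg}(G)$ and $D^{\deg}(K_n)$ have the same Smith normal form, then $G$ is isomorphic to $K_n$. (That is, complete graphs are determined by the SNF of $D^{\deg}$.)
   Context: For a connected graph $G$, $D(G)$ is the distance matrix, with $uv$-entry the number of edges in a shortest path between $u$ and $v$, and $\deg(G)$ is the diagonal matrix of vertex degrees. Define $D^{\deg}(G)=\deg(G)-D(G)$. The Smith normal form (SNF) of a square integer matrix $M$ of size $n$ is the unique diagonal matrix $\operatorname{diag}(f_1,\dots,f_r,0,\dots,0)=PMQ$ with $P,Q\in GL_n(\mathbb{Z})$, $f_i$ positive integers, $f_i\mid f_{i+1}$, $r$ the rank of $M$ (so matrices with equal SNF have the same size). *)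

theory Defs
  imports "Graph_Theory.Graph_Theory" "Jordan_Normal_Form.DL_Rank"
begin

text \<open>
  A finite simple graph is a digraph satisfying the locale predicate \<^const>\<open>graph\<close>: every edge
  \<open>uv\<close> is represented by the two opposite arcs \<open>(u,v)\<close> and \<open>(v,u)\<close>, so a path uses as many
  arcs as edges, and the degree of a vertex is its number of outgoing arcs.
\<close>

definition graph_dist :: "('a, 'b) pre_digraph \<Rightarrow> 'a \<Rightarrow> 'a \<Rightarrow> nat" where
  "graph_dist G u v = (LEAST k. \<exists>p. pre_digraph.apath G u p v \<and> length p = k)"

text \<open>
  Rows and columns of the matrices below are indexed by positions in a list \<open>vs\<close> that enumerates
  the vertices of \<open>G\<close> without repetition.
\<close>

definition vertex_enum :: "('a, 'b) pre_digraph \<Rightarrow> 'a list \<Rightarrow> bool" where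
  "vertex_enum G vs \<longleftrightarrow> distinct vs \<and> set vs = verts G"

definition distance_mat :: "('a, 'b) pre_digraph \<Rightarrow> 'a list \<Rightarrow> int mat" where
  "distance_mat G vs =
    mat (length vs) (length vs) (\<lambda>(i, j). int (graph_dist G (vs ! i) (vs ! j)))"

definition degree_mat :: "('a, 'b) pre_digraph \<Rightarrow> 'a list \<Rightarrow> int mat" where
  "degree_mat G vs =
    mat (length vs) (length vs) (\<lambda>(i, j). if i = j then int (out_degree G (vs ! i)) else 0)"

definition deg_distance_mat :: "('a, 'b) pre_digraph \<Rightarrow> 'a list \<Rightarrow> int mat" where
  "deg_distance_mat G vs = degree_mat G vs - distance_mat G vs"

text \<open>
  The rank of an integer matrix is its rank over the rationals; the rank function of the library
  takes the number of rows as its first argument.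
\<close>

definition int_mat_rank :: "int mat \<Rightarrow> nat" where
  "int_mat_rank M = vec_space.rank (dim_row M) (map_mat rat_of_int M)"

definition is_smith_normal_form :: "int mat \<Rightarrow> int mat \<Rightarrow> bool" where
  "is_smith_normal_form M S \<longleftrightarrow>
    (\<exists>n r P Q.
      M \<in> carrier_mat n n \<and> S \<in> carrier_mat n n \<and>
      P \<in> carrier_mat n n \<and> invertible_mat P \<and>
      Q \<in> carrier_mat n n \<and> invertible_mat Q \<and>
      S = P * M * Q \<and>
      r = int_mat_rank M \<and>
      diagonal_mat S \<and>
      (\<forall>i<r. S $$ (i, i) > 0) \<and>
      (\<forall>i. Suc i < r \<longrightarrow> S $$ (i, i) dvd S $$ (Suc i, Suc i)) \<and>
      (\<forall>i. r \<le> i \<and> i < n \<longrightarrow> S $$ (i, i) = 0))"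

text \<open>
  Every square integer matrix has exactly one Smith normal form, so having the same one amounts to
  the existence of a common one.
\<close>

definition same_smith_normal_form :: "int mat \<Rightarrow> int mat \<Rightarrow> bool" where
  "same_smith_normal_form M N \<longleftrightarrow>
    (\<exists>S. is_smith_normal_form M S \<and> is_smith_normal_form N S)"

end

theory Submission
  imports Defs "HOL-Number_Theory.Cong"
begin

text \<open>
  The matrix of \<open>K\<^sub>n\<close> is \<open>n I - J\<close>, where \<open>J\<close> is the all-ones matrix. Modulo \<open>n\<close> it is the product
  of a column and a row, so all its \<open>2 \<times> 2\<close> minors are divisible by \<open>n\<close>. Two matrices with a
  common Smith normal form are related by \<open>M = A N B\<close> with integer \<open>A\<close> and \<open>B\<close>, and
  multiplication on either side preserves being such a product modulo \<open>n\<close>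
  (\<open>outer_product_mod_same_smith_normal_form\<close>). So a graph \<open>G\<close> with the Smith normal form of
  \<open>K\<^sub>n\<close> has \<open>n\<close> vertices, and all \<open>2 \<times> 2\<close> minors of its matrix are divisible by \<open>n\<close>; this
  divisibility alone forces \<open>G\<close> to be complete (\<open>complete_if_outer_product_mod\<close>).

  Suppose that \<open>G\<close> is connected but not complete. Then it has an induced path \<open>u v w\<close>, whose
  ends are at distance two. One minor on the vertices of the path shows that the end \<open>u\<close> has
  degree \<open>-2\<close> modulo \<open>n\<close>, another one that the degree \<open>d\<close> of the middle \<open>v\<close> satisfies
  \<open>2 d \<equiv> -1\<close>. If \<open>v\<close> is adjacent to all other vertices, then \<open>d = n - 1\<close>, and \<open>n\<close> divides
  \<open>1\<close>. Otherwise \<open>v\<close> is itself an end of another induced path with three vertices, so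
  \<open>d \<equiv> -2\<close> as well, and \<open>n\<close> divides \<open>2 (d + 2) - (2 d + 1) = 3\<close>. As \<open>v\<close> has two neighbours,
  \<open>2 \<le> d < n \<le> 3\<close>, whence \<open>d = 2\<close> and \<open>n = 3\<close>, but \<open>3\<close> does not divide \<open>2 d + 1 = 5\<close>.
\<close>

section \<open>Degrees and short distances\<close>

text \<open>
  Out-degrees count arcs; without parallel arcs, an arc leaving \<open>v\<close> is determined by its head.
\<close>

lemma (in digraph) out_degree_eq_card_dominated:
  "out_degree G v = card {w. v \<rightarrow>\<^bsub>G\<^esub> w}"
proof -
  have "inj_on (head G) (out_arcs G v)"
    by (auto intro!: inj_onI no_multi_arcs simp: out_arcs_def arc_to_ends_def)
  moreover have "head G ` out_arcs G v = {w. v \<rightarrow>\<^bsub>G\<^esub> w}"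
    by (auto simp: out_arcs_def arcs_ends_conv)
  ultimately show ?thesis
    unfolding out_degree_def by (metis card_image)
qed

lemma (in digraph) dominated_subset: "{w. v \<rightarrow>\<^bsub>G\<^esub> w} \<subseteq> verts G - {v}"
  by (auto dest: adj_not_same elim: adj_in_verts)

lemma (in digraph) out_degree_less_card_verts:
  assumes "v \<in> verts G"
  shows "out_degree G v < card (verts G)"
proof -
  have "card {w. v \<rightarrow>\<^bsub>G\<^esub> w} \<le> card (verts G - {v})"
    by (intro card_mono dominated_subset) simp
  also have "\<dots> < card (verts G)"
    using assms by (intro psubset_card_mono) auto
  finally show ?thesis
    by (simp add: out_degree_eq_card_dominated)
qed

lemma (in digraph) out_degree_dominating:
  assumes "v \<in> verts G" "\<And>w. w \<in> verts G \<Longrightarrow> w \<noteq> v \<Longrightarrow> v \<rightarrow>\<^bsub>G\<^esub> w"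
  shows "out_degree G v = card (verts G) - 1"
proof -
  have "{w. v \<rightarrow>\<^bsub>G\<^esub> w} = verts G - {v}"
    using assms dominated_subset by blast
  then show ?thesis
    using assms(1) by (simp add: out_degree_eq_card_dominated)
qed

lemma (in digraph) out_degree_ge_2:
  assumes "v \<rightarrow>\<^bsub>G\<^esub> u" "v \<rightarrow>\<^bsub>G\<^esub> w" "u \<noteq> w"
  shows "2 \<le> out_degree G v"
proof -
  have "card {u, w} \<le> card {w. v \<rightarrow>\<^bsub>G\<^esub> w}"
    using assms by (intro card_mono finite_subset[OF dominated_subset]) auto
  then show ?thesis
    using assms(3) by (simp add: out_degree_eq_card_dominated)
qed

lemma (in wf_digraph) apath_length_0_iff:
  "(\<exists>p. apath u p v \<and> length p = 0) \<longleftrightarrow> u = v \<and> u \<in> verts G"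
  by (auto simp: apath_def awalk_def)

lemma (in loopfree_digraph) apath_length_1_iff:
  "(\<exists>p. apath u p v \<and> length p = Suc 0) \<longleftrightarrow> u \<rightarrow>\<^bsub>G\<^esub> v"
proof
  assume "\<exists>p. apath u p v \<and> length p = Suc 0"
  then show "u \<rightarrow>\<^bsub>G\<^esub> v"
    by (auto simp: length_Suc_conv apath_def awalk_def arcs_ends_conv image_iff)
next
  assume "u \<rightarrow>\<^bsub>G\<^esub> v"
  then obtain e where "e \<in> arcs G" "tail G e = u" "head G e = v"
    by (rule reachableE)
  then have "apath u [e] v"
    using no_loops[of e] by (auto simp: apath_def awalk_def)
  then show "\<exists>p. apath u p v \<and> length p = Suc 0"
    by force
qed

lemma (in wf_digraph) graph_dist_self:
  assumes "u \<in> verts G"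
  shows "graph_dist G u u = 0"
  unfolding graph_dist_def using apath_length_0_iff[of u u] assms
  by (intro Least_equality) auto

lemma (in loopfree_digraph) graph_dist_adjacent:
  assumes "u \<rightarrow>\<^bsub>G\<^esub> v"
  shows "graph_dist G u v = 1"
  unfolding graph_dist_def
proof (rule Least_equality)
  show "\<exists>p. apath u p v \<and> length p = 1"
    using assms apath_length_1_iff by simp
next
  fix k assume k: "\<exists>p. apath u p v \<and> length p = k"
  have "u \<noteq> v"
    using assms adj_not_same by auto
  with k apath_length_0_iff[of u v] have "k \<noteq> 0"
    by blast
  then show "1 \<le> k" by simp
qed

lemma (in loopfree_digraph) graph_dist_two:
  assumes "u \<rightarrow>\<^bsub>G\<^esub> v" "v \<rightarrow>\<^bsub>G\<^esub> w" "u \<noteq> w" "\<not> u \<rightarrow>\<^bsub>G\<^esub> w"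
  shows "graph_dist G u w = 2"
  unfolding graph_dist_def
proof (rule Least_equality)
  obtain e where e: "e \<in> arcs G" "tail G e = u" "head G e = v"
    using assms(1) by (rule reachableE)
  obtain f where f: "f \<in> arcs G" "tail G f = v" "head G f = w"
    using assms(2) by (rule reachableE)
  have "apath u [e, f] w"
    using e f no_loops[of e] no_loops[of f] assms(3) by (auto simp: apath_def awalk_def)
  then show "\<exists>p. apath u p w \<and> length p = 2"
    by force
next
  fix k assume k: "\<exists>p. apath u p w \<and> length p = k"
  have "k \<noteq> 0"
    using k apath_length_0_iff[of u w] assms(3) by blast
  moreover have "k \<noteq> Suc 0"
    using k apath_length_1_iff[of u w] assms(4) by blast
  ultimately show "2 \<le> k" by simp
qed

text \<open>
  If no vertex were at distance two from \<open>x\<close>, then \<open>x\<close> together with the vertices that it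
  dominates would be closed under following arcs, and would contain all that \<open>x\<close> reaches.
\<close>

lemma (in wf_digraph) reachable_not_dominated_distance_two:
  assumes "x \<rightarrow>\<^sup>* y" "x \<noteq> y" "\<not> x \<rightarrow>\<^bsub>G\<^esub> y"
  obtains v w where "x \<rightarrow>\<^bsub>G\<^esub> v" "v \<rightarrow>\<^bsub>G\<^esub> w" "x \<noteq> w" "\<not> x \<rightarrow>\<^bsub>G\<^esub> w"
proof -
  have "\<exists>v w. x \<rightarrow>\<^bsub>G\<^esub> v \<and> v \<rightarrow>\<^bsub>G\<^esub> w \<and> x \<noteq> w \<and> \<not> x \<rightarrow>\<^bsub>G\<^esub> w"
    using assms
  proof (induction rule: reachable_induct)
    case (step y z)
    then show ?case
      by (cases "x = y \<or> x \<rightarrow>\<^bsub>G\<^esub> y") auto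
  qed simp
  then show ?thesis
    using that by blast
qed

section \<open>Matrices congruent to a product of a column and a row\<close>

definition outer_product_mod :: "int \<Rightarrow> int mat \<Rightarrow> bool" where
  "outer_product_mod m M \<longleftrightarrow>
    (\<exists>a b. \<forall>i < dim_row M. \<forall>j < dim_col M. [M $$ (i, j) = a i * b j] (mod m))"

lemma outer_product_mod_minor:
  assumes "outer_product_mod m M"
    and "i < dim_row M" "k < dim_row M" "j < dim_col M" "l < dim_col M"
  shows "[M $$ (i, j) * M $$ (k, l) = M $$ (i, l) * M $$ (k, j)] (mod m)"
proof -
  obtain a b where
    ab: "\<And>i j. i < dim_row M \<Longrightarrow> j < dim_col M \<Longrightarrow> [M $$ (i, j) = a i * b j] (mod m)"
    using assms(1) unfolding outer_product_mod_def by blast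
  have "[M $$ (i, j) * M $$ (k, l) = (a i * b j) * (a k * b l)] (mod m)"
    using assms by (intro cong_mult ab)
  moreover have "[M $$ (i, l) * M $$ (k, j) = (a i * b l) * (a k * b j)] (mod m)"
    using assms by (intro cong_mult ab)
  moreover have "(a i * b j) * (a k * b l) = (a i * b l) * (a k * b j)"
    by simp
  ultimately show ?thesis
    by (metis cong_sym cong_trans)
qed

text \<open>
  If \<open>M\<close> is congruent to \<open>a b\<^sup>T\<close>, then \<open>A M\<close> is congruent to \<open>(A a) b\<^sup>T\<close>. The corresponding fact
  for multiplication on the right follows by transposition.
\<close>

lemma outer_product_mod_mult_left:
  assumes "outer_product_mod m M" "dim_col A = dim_row M"
  shows "outer_product_mod m (A * M)"
proof -
  obtain a b where
    ab: "\<And>i j. i < dim_row M \<Longrightarrow> j < dim_col M \<Longrightarrow> [M $$ (i, j) = a i * b j] (mod m)"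
    using assms(1) unfolding outer_product_mod_def by blast
  have "[(A * M) $$ (i, j) = (\<Sum>k = 0..<dim_row M. A $$ (i, k) * a k) * b j] (mod m)"
    if "i < dim_row A" "j < dim_col M" for i j
  proof -
    have "(A * M) $$ (i, j) = (\<Sum>k = 0..<dim_row M. A $$ (i, k) * M $$ (k, j))"
      using that assms(2) by (simp add: scalar_prod_def)
    moreover have "[(\<Sum>k = 0..<dim_row M. A $$ (i, k) * M $$ (k, j))
        = (\<Sum>k = 0..<dim_row M. A $$ (i, k) * (a k * b j))] (mod m)"
      using that by (intro cong_sum cong_mult ab) auto
    ultimately show ?thesis
      by (simp add: sum_distrib_right mult.assoc)
  qed
  then show ?thesis
    unfolding outer_product_mod_def
    by (intro exI[of _ "\<lambda>i. \<Sum>k = 0..<dim_row M. A $$ (i, k) * a k"] exI[of _ b]) simp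
qed

lemma outer_product_mod_transpose:
  "outer_product_mod m (transpose_mat M) \<longleftrightarrow> outer_product_mod m M"
  unfolding outer_product_mod_def
  by (simp add: mult.commute) (metis mult.commute)

lemma outer_product_mod_mult_right:
  assumes "outer_product_mod m M" "dim_row B = dim_col M"
  shows "outer_product_mod m (M * B)"
proof -
  have "outer_product_mod m (transpose_mat B * transpose_mat M)"
    using assms by (intro outer_product_mod_mult_left) (auto simp: outer_product_mod_transpose)
  moreover have "transpose_mat B * transpose_mat M = transpose_mat (M * B)"
    using assms(2) by (intro transpose_mult[symmetric, of _ "dim_row M" "dim_col M"]) auto
  ultimately show ?thesis
    using outer_product_mod_transpose by metis
qed

lemma invertible_mat_inverseE:
  assumes "invertible_mat P" "P \<in> carrier_mat n n"
  obtains P' where "P' \<in> carrier_mat n n" "P' * P = 1\<^sub>m n" "P * P' = 1\<^sub>m n"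
proof -
  obtain P' where P': "P * P' = 1\<^sub>m n" "P' * P = 1\<^sub>m (dim_row P')"
    using assms unfolding invertible_mat_def inverts_mat_def by auto
  have "dim_col P' = n"
    using arg_cong[OF P'(1), of dim_col] by simp
  moreover have "dim_row P' = n"
    using arg_cong[OF P'(2), of dim_col] assms(2) by simp
  ultimately show ?thesis
    using P' that[of P'] by auto
qed

text \<open>
  From \<open>P M Q = S = P\<^sub>2 N Q\<^sub>2\<close> with \<open>P\<close> and \<open>Q\<close> invertible over the integers one gets
  \<open>M = (P\<inverse> P\<^sub>2) N (Q\<^sub>2 Q\<inverse>)\<close>. This equation transports divisibility properties from \<open>N\<close> to \<open>M\<close>.
\<close>

lemma same_smith_normal_formE:
  assumes "same_smith_normal_form M N"
  obtains n A B where "M \<in> carrier_mat n n" "N \<in> carrier_mat n n"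
    "A \<in> carrier_mat n n" "B \<in> carrier_mat n n" "M = A * N * B"
proof -
  obtain S where "is_smith_normal_form M S" "is_smith_normal_form N S"
    using assms unfolding same_smith_normal_form_def by blast
  then obtain n P Q P2 Q2 where
    c: "M \<in> carrier_mat n n" "N \<in> carrier_mat n n"
      "P \<in> carrier_mat n n" "Q \<in> carrier_mat n n"
      "P2 \<in> carrier_mat n n" "Q2 \<in> carrier_mat n n" and
    inv: "invertible_mat P" "invertible_mat Q" and
    S: "S = P * M * Q" "S = P2 * N * Q2"
    unfolding is_smith_normal_form_def by (elim exE conjE) (metis carrier_matD(1))
  obtain P' where P': "P' \<in> carrier_mat n n" "P' * P = 1\<^sub>m n"
    using invertible_mat_inverseE inv(1) c(3) by blast
  obtain Q' where Q': "Q' \<in> carrier_mat n n" "Q * Q' = 1\<^sub>m n"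
    using invertible_mat_inverseE inv(2) c(4) by blast
  have "M = (P' * P) * M * (Q * Q')"
    using c P' Q' by simp
  also have "\<dots> = P' * S * Q'"
    unfolding S(1) using c P'(1) Q'(1) by (simp add: assoc_mult_mat[of _ n n _ n _ n])
  also have "\<dots> = (P' * P2) * N * (Q2 * Q')"
    unfolding S(2) using c P'(1) Q'(1) by (simp add: assoc_mult_mat[of _ n n _ n _ n])
  finally show ?thesis
    using c P' Q' by (intro that[of n "P' * P2" "Q2 * Q'"]) auto
qed

lemma outer_product_mod_same_smith_normal_form:
  assumes "same_smith_normal_form M N" "outer_product_mod m N"
  shows "outer_product_mod m M"
proof -
  obtain n A B where c: "N \<in> carrier_mat n n" "A \<in> carrier_mat n n" "B \<in> carrier_mat n n"
    and M: "M = A * N * B"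
    using assms(1) by (rule same_smith_normal_formE)
  show ?thesis
    unfolding M using c assms(2)
    by (intro outer_product_mod_mult_right outer_product_mod_mult_left) auto
qed

section \<open>The complete graph\<close>

lemma dim_deg_distance_mat [simp]:
  "dim_row (deg_distance_mat G vs) = length vs"
  "dim_col (deg_distance_mat G vs) = length vs"
  by (simp_all add: deg_distance_mat_def degree_mat_def distance_mat_def)

lemma index_deg_distance_mat:
  assumes "i < length vs" "j < length vs"
  shows "deg_distance_mat G vs $$ (i, j) =
    (if i = j then int (out_degree G (vs ! i)) else 0) - int (graph_dist G (vs ! i) (vs ! j))"
  using assms by (simp add: deg_distance_mat_def degree_mat_def distance_mat_def)

text \<open>
  The diagonal entries are \<open>n - 1\<close> and the others are \<open>-1\<close>, so modulo \<open>n\<close> all entries agree.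
\<close>

lemma complete_digraph_outer_product_mod:
  assumes "complete_digraph n K" "vertex_enum K ws"
  shows "outer_product_mod (int n) (deg_distance_mat K ws)"
proof -
  interpret graph K
    using assms(1) by (simp add: complete_digraph_def)
  have n: "card (verts K) = n" and
    adj: "u \<rightarrow>\<^bsub>K\<^esub> v \<longleftrightarrow> u \<in> verts K \<and> v \<in> verts K \<and> u \<noteq> v" for u v
    using assms(1) by (auto simp: complete_digraph_def)
  have ws: "distinct ws" "set ws = verts K"
    using assms(2) by (auto simp: vertex_enum_def)
  have "[deg_distance_mat K ws $$ (i, j) = (- 1) * 1] (mod int n)"
    if "i < length ws" "j < length ws" for i j
  proof (cases "i = j")
    case True
    have v: "ws ! i \<in> verts K"
      using that(1) ws(2) nth_mem by blast
    then have "out_degree K (ws ! i) = n - 1" "n > 0"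
      using out_degree_dominating[of "ws ! i"] n adj by (auto simp: card_gt_0_iff)
    then have "deg_distance_mat K ws $$ (i, j) = int n - 1"
      using True that graph_dist_self[OF v]
      by (simp add: index_deg_distance_mat of_nat_diff)
    then show ?thesis
      by (simp add: cong_iff_dvd_diff)
  next
    case False
    then have "ws ! i \<rightarrow>\<^bsub>K\<^esub> ws ! j"
      unfolding adj using that ws nth_mem nth_eq_iff_index_eq by blast
    then have "deg_distance_mat K ws $$ (i, j) = - 1"
      using False that graph_dist_adjacent
      by (simp add: index_deg_distance_mat)
    then show ?thesis
      by simp
  qed
  then show ?thesis
    unfolding outer_product_mod_def
    by (intro exI[of _ "\<lambda>_. - 1"] exI[of _ "\<lambda>_. 1"]) simp
qed

text \<open>
  Any bijection \<open>f\<close> of the vertices extends to an isomorphism: in both digraphs the arcs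
  correspond one to one to the pairs of distinct vertices, so an arc \<open>e\<close> of \<open>G\<close> has to go to the
  arc of \<open>K\<close> whose ends are the images under \<open>f\<close> of the ends of \<open>e\<close>.
\<close>

lemma digraph_iso_complete:
  assumes "complete_digraph n G" "complete_digraph n K"
  shows "digraph_iso G K"
proof -
  interpret G: graph G
    using assms(1) by (simp add: complete_digraph_def)
  interpret K: graph K
    using assms(2) by (simp add: complete_digraph_def)
  have endsG: "arc_to_ends G ` arcs G = {(u, v). u \<in> verts G \<and> v \<in> verts G \<and> u \<noteq> v}"
    using assms(1) by (auto simp: complete_digraph_def arcs_ends_def)
  have endsK: "arc_to_ends K ` arcs K = {(u, v). u \<in> verts K \<and> v \<in> verts K \<and> u \<noteq> v}"
    using assms(2) by (auto simp: complete_digraph_def arcs_ends_def)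
  have "card (verts G) = card (verts K)"
    using assms by (simp add: complete_digraph_def)
  then obtain f where f: "bij_betw f (verts G) (verts K)"
    using finite_same_card_bij[OF G.finite_verts K.finite_verts] by auto
  have f_inj: "inj_on f (verts G)" and f_image: "f ` verts G = verts K"
    using f by (auto simp: bij_betw_def)
  have bij_ends: "bij_betw (map_prod f f) (arc_to_ends G ` arcs G) (arc_to_ends K ` arcs K)"
    unfolding endsG endsK f_image[symmetric]
    by (rule bij_betw_imageI) (use f_inj in \<open>auto simp: inj_on_def image_iff\<close>)
  then have "bij_betw (map_prod f f \<circ> arc_to_ends G) (arcs G) (arc_to_ends K ` arcs K)"
    using G.inj_on_arc_to_ends by (intro bij_betw_trans) (auto simp: bij_betw_def)
  moreover have "bij_betw (the_inv_into (arcs K) (arc_to_ends K)) (arc_to_ends K ` arcs K) (arcs K)"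
    using K.inj_on_arc_to_ends by (intro bij_betw_the_inv_into) (auto simp: bij_betw_def)
  moreover define g where
    "g = the_inv_into (arcs K) (arc_to_ends K) \<circ> (map_prod f f \<circ> arc_to_ends G)"
  ultimately have g: "bij_betw g (arcs G) (arcs K)"
    using bij_betw_trans by blast
  have ends_g: "arc_to_ends K (g e) = map_prod f f (arc_to_ends G e)" if "e \<in> arcs G" for e
  proof -
    have "map_prod f f (arc_to_ends G e) \<in> arc_to_ends K ` arcs K"
      using bij_ends that by (auto simp: bij_betw_def)
    then show ?thesis
      unfolding g_def using K.inj_on_arc_to_ends by (simp add: f_the_inv_into_f)
  qed
  define h where "h = \<lparr>iso_verts = f, iso_arcs = g, iso_head = head K, iso_tail = tail K\<rparr>"
  have "G.digraph_isomorphism h"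
    using f g ends_g G.wf_digraph
    by (auto simp: G.digraph_isomorphism_def h_def bij_betw_def arc_to_ends_def)
  moreover have "K = app_iso h G"
    using f g by (auto simp: app_iso_def h_def bij_betw_def)
  ultimately show ?thesis
    unfolding digraph_iso_def by blast
qed

section \<open>Graphs whose matrix is an outer product modulo the order\<close>

text \<open>
  Each end of an induced path with three vertices has degree \<open>-2\<close> modulo the order \<open>n\<close>, and twice
  the degree of its middle is \<open>-1\<close>. Applied to the middle of one such path, which may be an end
  of another, this leaves no possible degree.
\<close>

lemma (in graph) complete_if_outer_product_mod:
  assumes "Digraph_Component.connected G" "vertex_enum G vs"
    and "outer_product_mod (int (card (verts G))) (deg_distance_mat G vs)"
  shows "complete_digraph (card (verts G)) G"
proof (rule ccontr)
  define n where "n = card (verts G)"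
  define d where "d v = int (out_degree G v)" for v
  \<comment> \<open>The matrix of the graph, indexed by vertices instead of positions in \<open>vs\<close>.\<close>
  define D where "D x y = (if x = y then d x else 0) - int (graph_dist G x y)" for x y
  have reach: "x \<rightarrow>\<^sup>* y" if "x \<in> verts G" "y \<in> verts G" for x y
    using symmetric_connected_imp_strongly_connected[OF sym_arcs assms(1)] that
    by (auto simp: strongly_connected_def)
  have D_minor: "[D x y * D x' y' = D x y' * D x' y] (mod int n)"
    if "x \<in> verts G" "x' \<in> verts G" "y \<in> verts G" "y' \<in> verts G" for x x' y y'
  proof -
    have vs: "distinct vs" "set vs = verts G"
      using assms(2) by (auto simp: vertex_enum_def)
    have D: "deg_distance_mat G vs $$ (i, j) = D (vs ! i) (vs ! j)"
      if "i < length vs" "j < length vs" for i j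
      using that vs(1)
      by (simp add: index_deg_distance_mat D_def d_def nth_eq_iff_index_eq)
    have pos: "\<exists>i < length vs. z = vs ! i" if "z \<in> verts G" for z
      using that vs(2) by (metis in_set_conv_nth)
    obtain i j k l where ijkl:
      "i < length vs" "j < length vs" "k < length vs" "l < length vs"
      "x = vs ! i" "y = vs ! j" "x' = vs ! k" "y' = vs ! l"
      using pos[OF \<open>x \<in> verts G\<close>] pos[OF \<open>y \<in> verts G\<close>] pos[OF \<open>x' \<in> verts G\<close>]
        pos[OF \<open>y' \<in> verts G\<close>] by blast
    show ?thesis
      using outer_product_mod_minor[OF assms(3), of i k j l] ijkl
      by (simp add: D n_def)
  qed
  have D_diag: "D v v = d v" if "v \<in> verts G" for v
    using graph_dist_self[OF that] by (simp add: D_def)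
  have D_adj: "D u v = - 1" if "u \<rightarrow>\<^bsub>G\<^esub> v" for u v
    using graph_dist_adjacent[OF that] adj_not_same that by (auto simp: D_def)
  have D_two: "D u w = - 2" if "u \<rightarrow>\<^bsub>G\<^esub> v" "v \<rightarrow>\<^bsub>G\<^esub> w" "u \<noteq> w" "\<not> u \<rightarrow>\<^bsub>G\<^esub> w" for u v w
    using graph_dist_two[OF that] that(3) by (simp add: D_def)
  have degrees: "[d u = - 2] (mod int n)" "[2 * d v = - 1] (mod int n)"
    if path: "u \<rightarrow>\<^bsub>G\<^esub> v" "v \<rightarrow>\<^bsub>G\<^esub> w" "u \<noteq> w" "\<not> u \<rightarrow>\<^bsub>G\<^esub> w" for u v w
  proof -
    have verts: "u \<in> verts G" "v \<in> verts G" "w \<in> verts G"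
      using path by (auto elim: adj_in_verts)
    \<comment> \<open>The minor with rows \<open>v, u\<close> and columns \<open>u, w\<close> contains the degree of the end \<open>u\<close> only.\<close>
    have "[D v u * D u w = D v w * D u u] (mod int n)"
      using D_minor verts by blast
    then have "[2 = - d u] (mod int n)"
      using D_adj[OF graph_symmetric[OF path(1)]] D_adj[OF path(2)] D_two[OF path]
        D_diag[OF verts(1)] by simp
    then show "[d u = - 2] (mod int n)"
      by (simp add: cong_iff_dvd_diff algebra_simps)
    \<comment> \<open>The minor with rows \<open>u, v\<close> and columns \<open>v, w\<close> contains the degree of the middle \<open>v\<close> only.\<close>
    have "[D u v * D v w = D u w * D v v] (mod int n)"
      using D_minor verts by blast
    then have "[1 = - 2 * d v] (mod int n)"
      using D_adj[OF path(1)] D_adj[OF path(2)] D_two[OF path] D_diag[OF verts(2)] by simp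
    then show "[2 * d v = - 1] (mod int n)"
      by (simp add: cong_iff_dvd_diff algebra_simps)
  qed
  assume "\<not> complete_digraph (card (verts G)) G"
  then obtain x y where "x \<in> verts G" "y \<in> verts G" "x \<noteq> y" "\<not> x \<rightarrow>\<^bsub>G\<^esub> y"
    using graph_axioms dominated_subset
    by (auto simp: complete_digraph_def)
  then obtain u v w where path: "u \<rightarrow>\<^bsub>G\<^esub> v" "v \<rightarrow>\<^bsub>G\<^esub> w" "u \<noteq> w" "\<not> u \<rightarrow>\<^bsub>G\<^esub> w"
    using reachable_not_dominated_distance_two reach by metis
  have v: "v \<in> verts G"
    using path(1) by (auto elim: adj_in_verts)
  have mid: "int n dvd 2 * d v + 1"
    using degrees(2)[OF path] by (simp add: cong_iff_dvd_diff)
  have ge: "2 \<le> d v" and less: "d v < int n"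
    using out_degree_ge_2[OF graph_symmetric[OF path(1)] path(2,3)]
      out_degree_less_card_verts[OF v] by (simp_all add: d_def n_def)
  show False
  proof (cases "\<forall>z \<in> verts G. z \<noteq> v \<longrightarrow> v \<rightarrow>\<^bsub>G\<^esub> z")
    case True
    then have "d v = int n - 1"
      using out_degree_dominating[OF v] ge by (simp add: d_def n_def)
    then have "2 * int n - (2 * d v + 1) = 1"
      by simp
    moreover have "int n dvd 2 * int n - (2 * d v + 1)"
      using mid by (intro dvd_diff) auto
    ultimately have "int n dvd 1"
      by metis
    then show False
      using ge less by simp
  next
    case False
    \<comment> \<open>Now \<open>v\<close> is an end of an induced path \<open>v v' w'\<close>.\<close>
    then obtain v' w' where "v \<rightarrow>\<^bsub>G\<^esub> v'" "v' \<rightarrow>\<^bsub>G\<^esub> w'" "v \<noteq> w'" "\<not> v \<rightarrow>\<^bsub>G\<^esub> w'"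
      using reachable_not_dominated_distance_two reach v by metis
    then have "int n dvd d v + 2"
      using degrees(1) by (simp add: cong_iff_dvd_diff)
    then have "int n dvd 2 * (d v + 2) - (2 * d v + 1)"
      using mid by (intro dvd_diff dvd_mult)
    then have "int n dvd 3"
      by simp
    then have "int n \<le> 3"
      by (rule zdvd_imp_le) simp
    then have "d v = 2" "int n = 3"
      using ge less by auto
    then show False
      using mid by simp
  qed
qed

theorem theorem3p17:
  fixes n :: nat
    and G :: "('a, 'b) pre_digraph" and vs :: "'a list"
    and K :: "('c, 'd) pre_digraph" and ws :: "'c list"
  assumes "n \<ge> 1"
    and "complete_digraph n K" and "vertex_enum K ws"
    and "graph G" and "Digraph_Component.connected G" and "vertex_enum G vs"
    and "same_smith_normal_form (deg_distance_mat G vs) (deg_distance_mat K ws)"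
  shows "digraph_iso G K"
proof -
  interpret G: graph G
    by fact
  obtain m where "deg_distance_mat G vs \<in> carrier_mat m m" "deg_distance_mat K ws \<in> carrier_mat m m"
    using assms(7) by (rule same_smith_normal_formE)
  then have "length vs = length ws"
    by (auto dest!: carrier_matD(1))
  moreover have "card (verts G) = length vs" "card (verts K) = length ws"
    using assms(3,6) unfolding vertex_enum_def by (metis distinct_card)+
  ultimately have n: "card (verts G) = n"
    using assms(2) by (simp add: complete_digraph_def)
  have "outer_product_mod (int (card (verts G))) (deg_distance_mat G vs)"
    unfolding n using assms(7) complete_digraph_outer_product_mod[OF assms(2,3)]
    by (rule outer_product_mod_same_smith_normal_form)
  then have "complete_digraph n G"
    using G.complete_if_outer_product_mod[OF assms(5,6)] n by simp
  then show ?thesis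
    using assms(2) by (rule digraph_iso_complete)
qed

end
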